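(* Let $A_1,A_2,A_3\in M_2(\mathbb{C})$ be self-adjoint, written as $A_j=\sum_{k=0}^3 a_{jk}\sigma_k$ with $a_{jk}\in\mathbb{R}$, and suppose $A_1$ is diagonal, i.e. $a_{11}=a_{12}=0$. For $x\in\mathbb{R}^3$ let $D(x)=\det L_x(A_1,A_2,A_3)$. Then for all $(x_1,x_2,x_3)\in\mathbb{R}^3$, $$D(x_1,x_2,x_3)=D(2a_{10}-x_1,\;2a_{20}-x_2,\;2a_{30}-x_3).$$ Consequently every level surface $\{x\in\mathbb{R}^3: D(x)=t\}$, $t\in\mathbb{R}$, is symmetric with respect to the point $(a_{10},a_{20},a_{30})$, and in particular so is the Clifford spectrum $\Lambda^{\mathrm{C}}(A_1,A_2,A_3)$.
   Context: Let $\sigma_0=\begin{bmatrix}1&0\\0&1\end{bmatrix}$, $\sigma_1=\begin{bmatrix}0&1\\1&0\end{bmatrix}$, $\sigma_2=\begin{bmatrix}0&-i\\i&0\end{bmatrix}$, $\sigma_3=\begin{bmatrix}1&0\\0&-1\end{bmatrix}$. Every self-adjoint matrix in $M_2(\mathbb{C})$ is uniquely a real linear combination of $\sigma_0,\dots,\sigma_3$. The localizer of self-adjoint matrices $A_1,A_2,A_3\in M_2(\mathbb{C})$ at $x=(x_1,x_2,x_3)\in\mathbb{R}^3$ is the $4\times4$ matrix $L_x(A_1,A_2,A_3)=\sum_{j=1}^3 (A_j-x_j\sigma_0)\otimes\sigma_j$, where $\otimes$ is the Kronecker product. The Clifford spectrum is $\Lambda^{\mathrm{C}}(A_1,A_2,A_3)=\{x\in\mathbb{R}^3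 : L_x(A_1,A_2,A_3)\text{ is not invertible}\}$. A set $S\subseteq\mathbb{R}^3$ is symmetric with respect to a point $p$ if $2p-x\in S$ whenever $x\in S$. *)

theory Defs
  imports "HOL-Analysis.Analysis"
begin

text \<open>Matrices are vectors of rows: \<open>A $ i $ j\<close> is the entry in row \<open>i\<close> and column \<open>j\<close>.
  Only the values of \<open>pauli\<close> at 0, 1, 2, 3 are meaningful.\<close>

definition pauli :: "nat \<Rightarrow> complex^2^2" where
  "pauli k =
     [vector [vector [1, 0], vector [0, 1]],
      vector [vector [0, 1], vector [1, 0]],
      vector [vector [0, - \<i>], vector [\<i>, 0]],
      vector [vector [1, 0], vector [0, - 1]]] ! k"

definition self_adjoint :: "complex^'n^'n \<Rightarrow> bool" where
  "self_adjoint A \<longleftrightarrow> (\<chi> i j. cnj (A $ j $ i)) = A"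

definition diagonal_matrix :: "'a::zero^'n^'n \<Rightarrow> bool" where
  "diagonal_matrix A \<longleftrightarrow> (\<forall>i j. i \<noteq> j \<longrightarrow> A $ i $ j = 0)"

text \<open>Rows and columns of the Kronecker product are indexed by pairs, the first component
  selecting the block; ordering the pairs lexicographically gives the usual block matrix.
  For two 2-by-2 matrices the index type \<open>2 \<times> 2\<close> has four elements.\<close>

definition kronecker :: "'a::times^'n^'m \<Rightarrow> 'a^'q^'p \<Rightarrow> 'a^('n \<times> 'q)^('m \<times> 'p)" where
  "kronecker A B = (\<chi> r c. A $ fst r $ fst c * B $ snd r $ snd c)"

definition localizer ::
  "complex^2^2 \<Rightarrow> complex^2^2 \<Rightarrow> complex^2^2 \<Rightarrow> real^3 \<Rightarrow> complex^(2 \<times> 2)^(2 \<times> 2)" where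
  "localizer A1 A2 A3 x =
     kronecker (A1 - (x $ 1) *\<^sub>R pauli 0) (pauli 1) +
     kronecker (A2 - (x $ 2) *\<^sub>R pauli 0) (pauli 2) +
     kronecker (A3 - (x $ 3) *\<^sub>R pauli 0) (pauli 3)"

definition clifford_spectrum ::
  "complex^2^2 \<Rightarrow> complex^2^2 \<Rightarrow> complex^2^2 \<Rightarrow> (real^3) set" where
  "clifford_spectrum A1 A2 A3 = {x. \<not> invertible (localizer A1 A2 A3 x)}"

definition symmetric_about :: "(real^3) set \<Rightarrow> real^3 \<Rightarrow> bool" where
  "symmetric_about S p \<longleftrightarrow> (\<forall>x\<in>S. 2 *\<^sub>R p - x \<in> S)"

end

theory Submission
  imports Defs
begin

text \<open>
  For a \<open>2 \<times> 2\<close> matrix \<open>M\<close>, conjugating the transpose by \<open>\<sigma>\<^sub>2\<close> gives the adjugate: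
  \<open>\<sigma>\<^sub>2 M\<^sup>T \<sigma>\<^sub>2 = (tr M) \<sigma>\<^sub>0 - M\<close>. This operation sends each of \<open>\<sigma>\<^sub>1\<close>, \<open>\<sigma>\<^sub>2\<close>, \<open>\<sigma>\<^sub>3\<close>, which
  have trace zero, to its negative. It sends \<open>A\<^sub>j - x\<^sub>j \<sigma>\<^sub>0\<close> to \<open>-(A\<^sub>j - (2 p\<^sub>j - x\<^sub>j) \<sigma>\<^sub>0)\<close> as soon as
  \<open>tr A\<^sub>j = 2 p\<^sub>j\<close>. Apply it to both tensor factors at once, that is, conjugate the
  transpose of the localizer by \<open>J = \<sigma>\<^sub>2 \<otimes> \<sigma>\<^sub>2\<close>. In each summand the two signs cancel, so
  \<open>L(2 p - x) = J L(x)\<^sup>T J\<close>; this is lemma \<open>localizer_reflect\<close>.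

  Since \<open>J\<^sup>2 = 1\<close>, the two localizers have the same determinant. The level surfaces of the
  determinant are then symmetric about \<open>p\<close>, and the Clifford spectrum is the level surface at
  zero. For \<open>A\<^sub>j = \<Sum>\<^sub>k a\<^sub>j\<^sub>k \<sigma>\<^sub>k\<close> only the \<open>\<sigma>\<^sub>0\<close> term contributes to the trace, which makes the
  centre \<open>p = (a\<^sub>1\<^sub>0, a\<^sub>2\<^sub>0, a\<^sub>3\<^sub>0)\<close>.
\<close>

lemma kronecker_mult:
  fixes A :: "'a::comm_semiring_1^'n^'m" and B :: "'a^'q^'p"
    and C :: "'a^'k^'n" and D :: "'a^'l^'q"
  shows "kronecker A B ** kronecker C D = kronecker (A ** C) (B ** D)"
  unfolding kronecker_def matrix_matrix_mult_def
  by (simp add: vec_eq_iff sum_product sum.cartesian_product case_prod_beta ac_simps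
        flip: UNIV_Times_UNIV)

lemma transpose_kronecker: "transpose (kronecker A B) = kronecker (transpose A) (transpose B)"
  by (simp add: kronecker_def transpose_def vec_eq_iff)

lemma kronecker_mat_1:
  "kronecker (mat 1) (mat 1) = (mat 1 :: 'a::semiring_1^('n::finite \<times> 'm::finite)^('n \<times> 'm))"
  by (auto simp: kronecker_def mat_def vec_eq_iff prod_eq_iff)

lemma kronecker_minus_minus:
  fixes A :: "'a::ring^'n^'m" and B :: "'a^'q^'p"
  shows "kronecker (- A) (- B) = kronecker A B"
  by (simp add: kronecker_def)

lemma transpose_add: "transpose (A + B) = transpose A + transpose B"
  by (simp add: transpose_def vec_eq_iff)

lemma matrix_matrix_mult_add_rdistrib: "(A + B) ** C = A ** C + B ** C"
  for C :: "'a::semiring_1^'n^'m"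
  by (simp add: matrix_matrix_mult_def vec_eq_iff distrib_right sum.distrib)

lemmas pauli_entries = pauli_def vec_eq_iff forall_2 vector_2

lemma pauli_0: "pauli 0 = mat 1"
  by (simp add: pauli_entries mat_def)

lemma pauli_2_squared: "pauli 2 ** pauli 2 = mat 1"
  by (simp add: pauli_entries matrix_matrix_mult_def sum_2 mat_def)

lemma trace_pauli:
  "trace (pauli 0) = 2" "trace (pauli 1) = 0" "trace (pauli 2) = 0" "trace (pauli 3) = 0"
  by (simp_all add: trace_def pauli_entries sum_2)

lemma trace_scaleR: "trace (c *\<^sub>R A) = c *\<^sub>R trace A"
  for A :: "'a::real_algebra_1^'n^'n"
  by (simp add: trace_def scaleR_sum_right)

lemma trace_pauli_sum: "trace (\<Sum>k=0..3. c k *\<^sub>R pauli k) = complex_of_real (2 * c 0)"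
proof -
  have "{0..3} = {0, 1, 2, 3 :: nat}"
    by auto
  then show ?thesis
    by (simp add: trace_add trace_scaleR trace_pauli trace_pauli[simplified]
          scaleR_conv_of_real[where 'a = complex])
qed

text \<open>The right-hand side is the adjugate of \<open>M\<close>: by Cayley--Hamilton its product with \<open>M\<close>
  is \<open>det M\<close> times the identity. The conjugation by \<open>\<sigma>\<^sub>2\<close> swaps the two diagonal entries and
  negates the off-diagonal ones.\<close>

lemma pauli_2_transpose_conjugate:
  "pauli 2 ** transpose M ** pauli 2 = mat (trace M) - M"
proof -
  have "\<i> * z * \<i> = - z" for z
    by (simp add: complex_eq_iff)
  then show ?thesis
    by (simp add: pauli_entries matrix_matrix_mult_def transpose_def sum_2 mat_def trace_def)
qed

lemma pauli_2_transpose_conjugate_pauli: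
  assumes "j \<in> {1, 2, 3}"
  shows "pauli 2 ** transpose (pauli j) ** pauli 2 = - pauli j"
  using assms by (auto simp: pauli_2_transpose_conjugate trace_pauli[simplified] mat_0)

lemma pauli_2_transpose_conjugate_shift:
  assumes "trace A = complex_of_real (2 * p)"
  shows "pauli 2 ** transpose (A - x *\<^sub>R pauli 0) ** pauli 2 = - (A - (2 * p - x) *\<^sub>R pauli 0)"
  unfolding pauli_2_transpose_conjugate trace_sub trace_scaleR trace_pauli assms
  by (simp add: pauli_0 vec_eq_iff mat_def scaleR_conv_of_real[where 'a = complex] algebra_simps)

lemma kronecker_transpose_conjugate:
  assumes "trace A = complex_of_real (2 * p)" and "j \<in> {1, 2, 3}"
  shows "kronecker (pauli 2) (pauli 2) ** transpose (kronecker (A - x *\<^sub>R pauli 0) (pauli j))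
           ** kronecker (pauli 2) (pauli 2)
         = kronecker (A - (2 * p - x) *\<^sub>R pauli 0) (pauli j)"
  unfolding transpose_kronecker kronecker_mult pauli_2_transpose_conjugate_shift[OF assms(1)]
    pauli_2_transpose_conjugate_pauli[OF assms(2)] kronecker_minus_minus ..

text \<open>Transposition followed by conjugation is additive, so the reflection can be carried out
  summand by summand, each \<open>A\<^sub>j\<close> fixing the coordinate \<open>p\<^sub>j\<close> of the centre by its trace.\<close>

lemma localizer_reflect:
  assumes "trace A1 = complex_of_real (2 * p $ 1)"
    and "trace A2 = complex_of_real (2 * p $ 2)"
    and "trace A3 = complex_of_real (2 * p $ 3)"
  shows "localizer A1 A2 A3 (2 *\<^sub>R p - x) =
    kronecker (pauli 2) (pauli 2) ** transpose (localizer A1 A2 A3 x)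
      ** kronecker (pauli 2) (pauli 2)"
  unfolding localizer_def transpose_add matrix_add_ldistrib matrix_matrix_mult_add_rdistrib
  using assms by (simp add: kronecker_transpose_conjugate)

lemma det_localizer_reflect:
  assumes "trace A1 = complex_of_real (2 * p $ 1)"
    and "trace A2 = complex_of_real (2 * p $ 2)"
    and "trace A3 = complex_of_real (2 * p $ 3)"
  shows "det (localizer A1 A2 A3 (2 *\<^sub>R p - x)) = det (localizer A1 A2 A3 x)"
proof -
  let ?J = "kronecker (pauli 2) (pauli 2)"
  have "?J ** ?J = mat 1"
    by (simp add: kronecker_mult pauli_2_squared kronecker_mat_1)
  then have "det ?J * det ?J = 1"
    by (metis det_mul det_I)
  then show ?thesis
    by (simp add: localizer_reflect[OF assms] det_mul det_transpose)
qed

theorem corollary2p2: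
  fixes A1 A2 A3 :: "complex^2^2" and a :: "nat \<Rightarrow> nat \<Rightarrow> real"
  assumes "self_adjoint A1" and "self_adjoint A2" and "self_adjoint A3"
    and "A1 = (\<Sum>k=0..3. a 1 k *\<^sub>R pauli k)"
    and "A2 = (\<Sum>k=0..3. a 2 k *\<^sub>R pauli k)"
    and "A3 = (\<Sum>k=0..3. a 3 k *\<^sub>R pauli k)"
    and "diagonal_matrix A1"
  shows "(\<forall>x1 x2 x3 :: real.
            det (localizer A1 A2 A3 (vector [x1, x2, x3])) =
            det (localizer A1 A2 A3
                  (vector [2 * a 1 0 - x1, 2 * a 2 0 - x2, 2 * a 3 0 - x3]))) \<and>
         (\<forall>t :: real.
            symmetric_about {x. det (localizer A1 A2 A3 x) = complex_of_real t}
              (vector [a 1 0, a 2 0, a 3 0])) \<and>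
         symmetric_about (clifford_spectrum A1 A2 A3) (vector [a 1 0, a 2 0, a 3 0])"
proof -
  define p :: "real^3" where "p = vector [a 1 0, a 2 0, a 3 0]"
  have reflect: "det (localizer A1 A2 A3 (2 *\<^sub>R p - x)) = det (localizer A1 A2 A3 x)" for x
    by (rule det_localizer_reflect) (simp_all only: assms(4-6) trace_pauli_sum p_def vector_3)
  have "vector [2 * a 1 0 - x1, 2 * a 2 0 - x2, 2 * a 3 0 - x3] = 2 *\<^sub>R p - vector [x1, x2, x3]"
    for x1 x2 x3
    by (simp add: p_def vec_eq_iff forall_3 vector_3)
  then show ?thesis
    by (simp add: reflect symmetric_about_def clifford_spectrum_def invertible_det_nz
          del: One_nat_def flip: p_def)
qed

end
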